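(* Let $\alpha=1/3$ and $c_1=c_2=c$, where $c,k_1,k_2>0$. The unique non-vanishing equilibrium $(5c,5c)$ of the map $G$ (defined in the context) is locally stable if $$c^2>\frac{3k_1+3k_2+\sqrt{9k_1^2-17k_1k_2+9k_2^2}}{2000}.$$ The system may undergo a period-doubling bifurcation when $$c^2=\frac{3k_1+3k_2+\sqrt{9k_1^2-17k_1k_2+9k_2^2}}{2000}.$$ Furthermore, there exist no other bifurcations of the equilibrium.
   Context: For $\alpha=1/3$ the dynamic Bertrand duopoly game is the iteration $(p_1(t+1),p_2(t+1))=G(p_1(t),p_2(t))$ with $$G(p_1,p_2)=\left(p_1+k_1\frac{-p_1\sqrt{p_1p_2}+(2p_2+3\sqrt{p_1p_2})c_1}{2p_1^2(\sqrt{p_1}+\sqrt{p_2})^2},\;\; p_2+k_2\frac{-p_2\sqrt{p_1p_2}+(2p_1+3\sqrt{p_1p_2})c_2}{2p_2^2(\sqrt{p_1}+\sqrt{p_2})^2}\right),$$ where $p_i$ are prices, $c_i>0$ are marginal costs and $k_i>0$ are adjustment speeds. An equilibrium is a fixed point; a non-vanishing equilibrium is one with $p_1>0$ and $p_2>0$. Let $M$ be the Jacobian matrix of $G$ at the equilibrium and set $$CD_1=1-\mathrm{Tr}(M)+\mathrm{Det}(M),\quad CD_2=1+\mathrm{Tr}(M)+\mathrm{Det}(M),\quad CD_3=1-\mathrm{Det}(M).$$ The conditions for local stability (Jury criterion) are $CD_1>0$, $CD_2>0$, $CD_3>0$. The system may undergo a fold, period-doubling, or Neimark-Sacker bifurcation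 when the equilibrium loses its stability at $CD_1=0$, $CD_2=0$, or $CD_3=0$, respectively. *)

theory Defs
  imports "HOL-Analysis.Analysis"
begin

(* The square roots and quotients are meaningful only for positive prices; elsewhere the
   values are those of the totalised operations. The notions below only look at the map
   near, or at, points with positive prices. *)
definition bertrand_map :: "real \<Rightarrow> real \<Rightarrow> real \<Rightarrow> real \<Rightarrow> real ^ 2 \<Rightarrow> real ^ 2" where
  "bertrand_map c1 c2 k1 k2 p = (let p1 = p $ 1; p2 = p $ 2 in vector
     [p1 + k1 * ((- p1 * sqrt (p1 * p2) + (2 * p2 + 3 * sqrt (p1 * p2)) * c1)
                 / (2 * p1\<^sup>2 * (sqrt p1 + sqrt p2)\<^sup>2)),
      p2 + k2 * ((- p2 * sqrt (p1 * p2) + (2 * p1 + 3 * sqrt (p1 * p2)) * c2)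
                 / (2 * p2\<^sup>2 * (sqrt p1 + sqrt p2)\<^sup>2))])"

definition equilibrium :: "('a \<Rightarrow> 'a) \<Rightarrow> 'a \<Rightarrow> bool" where
  "equilibrium f x \<longleftrightarrow> f x = x"

definition nonvanishing_equilibrium :: "(real ^ 2 \<Rightarrow> real ^ 2) \<Rightarrow> real ^ 2 \<Rightarrow> bool" where
  "nonvanishing_equilibrium f p \<longleftrightarrow> equilibrium f p \<and> p $ 1 > 0 \<and> p $ 2 > 0"

(* Local asymptotic stability: Lyapunov stable and locally attracting. *)
definition locally_stable :: "('a::metric_space \<Rightarrow> 'a) \<Rightarrow> 'a \<Rightarrow> bool" where
  "locally_stable f x \<longleftrightarrow> equilibrium f x
     \<and> (\<forall>e>0. \<exists>d>0. \<forall>y. dist y x < d \<longrightarrow> (\<forall>n. dist ((f ^^ n) y) x < e))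
     \<and> (\<exists>d>0. \<forall>y. dist y x < d \<longrightarrow> (\<lambda>n. (f ^^ n) y) \<longlonglongrightarrow> x)"

definition CD1 :: "real ^ 2 ^ 2 \<Rightarrow> real" where
  "CD1 M = 1 - trace M + det M"

definition CD2 :: "real ^ 2 ^ 2 \<Rightarrow> real" where
  "CD2 M = 1 + trace M + det M"

definition CD3 :: "real ^ 2 ^ 2 \<Rightarrow> real" where
  "CD3 M = 1 - det M"

(* In a family of maps F with equilibria E over the parameter set P, stability is lost at q
   if q lies on the boundary, relative to P, of the set of parameters for which the
   equilibrium is locally stable. *)
definition loses_stability ::
  "('q::topological_space \<Rightarrow> 'a::metric_space \<Rightarrow> 'a) \<Rightarrow> ('q \<Rightarrow> 'a) \<Rightarrow> 'q set \<Rightarrow> 'q \<Rightarrow> bool" where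
  "loses_stability F E P q \<longleftrightarrow> q \<in> P
     \<and> q \<in> closure {r \<in> P. locally_stable (F r) (E r)}
     \<and> q \<in> closure {r \<in> P. \<not> locally_stable (F r) (E r)}"

definition may_undergo_fold ::
  "('q::topological_space \<Rightarrow> real ^ 2 \<Rightarrow> real ^ 2) \<Rightarrow> ('q \<Rightarrow> real ^ 2) \<Rightarrow> 'q set \<Rightarrow> 'q \<Rightarrow> bool" where
  "may_undergo_fold F E P q \<longleftrightarrow>
     loses_stability F E P q \<and> CD1 (jacobian (F q) (at (E q))) = 0"

definition may_undergo_period_doubling ::
  "('q::topological_space \<Rightarrow> real ^ 2 \<Rightarrow> real ^ 2) \<Rightarrow> ('q \<Rightarrow> real ^ 2) \<Rightarrow> 'q set \<Rightarrow> 'q \<Rightarrow> bool" where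
  "may_undergo_period_doubling F E P q \<longleftrightarrow>
     loses_stability F E P q \<and> CD2 (jacobian (F q) (at (E q))) = 0"

definition may_undergo_neimark_sacker ::
  "('q::topological_space \<Rightarrow> real ^ 2 \<Rightarrow> real ^ 2) \<Rightarrow> ('q \<Rightarrow> real ^ 2) \<Rightarrow> 'q set \<Rightarrow> 'q \<Rightarrow> bool" where
  "may_undergo_neimark_sacker F E P q \<longleftrightarrow>
     loses_stability F E P q \<and> CD3 (jacobian (F q) (at (E q))) = 0"

(* The symmetric-cost family c1 = c2 = c, with parameter (c, k1, k2). *)
definition params :: "(real \<times> real \<times> real) set" where
  "params = {(c, k1, k2). c > 0 \<and> k1 > 0 \<and> k2 > 0}"

definition G_sym :: "real \<times> real \<times> real \<Rightarrow> real ^ 2 \<Rightarrow> real ^ 2" where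
  "G_sym = (\<lambda>(c, k1, k2). bertrand_map c c k1 k2)"

definition E_sym :: "real \<times> real \<times> real \<Rightarrow> real ^ 2" where
  "E_sym = (\<lambda>(c, k1, k2). vector [5 * c, 5 * c])"

definition threshold :: "real \<Rightarrow> real \<Rightarrow> real" where
  "threshold k1 k2 =
     (3 * k1 + 3 * k2 + sqrt (9 * k1\<^sup>2 - 17 * k1 * k2 + 9 * k2\<^sup>2)) / 2000"

end

theory Submission
  imports Defs
begin

text \<open>
  With \<open>a = k1 / (1000 c\<^sup>2)\<close> and \<open>b = k2 / (1000 c\<^sup>2)\<close> the Jacobian at \<open>(5c, 5c)\<close> has rows
  \<open>(1 - 6a, a)\<close> and \<open>(b, 1 - 6b)\<close>. Its eigenvalues are real, distinct and less than \<open>1\<close>, and the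
  smaller one is \<open>1 - 2 \<theta> / c\<^sup>2\<close>, where \<open>\<theta>\<close> is the threshold. Above the threshold a norm adapted
  to the eigenvectors is contracted; below it the smaller eigenvalue is less than \<open>-1\<close> and
  dominates the other in modulus, so a cone around its eigendirection is expanded. This second
  half also covers the parameters where \<open>CD2\<close> vanishes a second time (the smaller root in \<open>c\<^sup>2\<close>)
  or is positive again: the equilibrium is unstable there as well, and stability is lost
  exactly on the surface \<open>c\<^sup>2 = \<theta>\<close>.
\<close>

section \<open>Linearized stability and instability of fixed points\<close>

text \<open>The remainder of the derivative is small relative to \<open>norm\<close>, hence relative
  to the equivalent gauge \<open>N\<close>, so \<open>f\<close> itself contracts \<open>N\<close>
  near \<open>x\<close>. A general \<open>N\<close> is allowed because a linear map of spectral
  radius below 1 may fail to contract the given norm.\<close>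

lemma locally_stable_if_contracting_linearization:
  fixes f :: "'a::real_normed_vector \<Rightarrow> 'a" and N :: "'a \<Rightarrow> real"
  assumes fixed: "f x = x" and der: "(f has_derivative D) (at x)"
    and triangle: "\<And>u v. N (u + v) \<le> N u + N v"
    and lower: "\<And>v. norm v \<le> C * N v" and upper: "\<And>v. N v \<le> B * norm v"
    and contr: "\<And>v. N (D v) \<le> \<rho> * N v"
    and pos: "0 < B" "0 < C" and \<rho>: "0 \<le> \<rho>" "\<rho> < 1"
  shows "locally_stable f x"
proof -
  \<comment> \<open>The rate \<open>\<sigma>\<close> is the midpoint of \<open>\<rho>\<close> and 1,
    and \<open>\<epsilon>\<close> is chosen so that the remainder costs at most
    \<open>B * \<epsilon> * C = \<sigma> - \<rho>\<close>.\<close>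
  define \<sigma> where "\<sigma> = (1 + \<rho>) / 2"
  define \<epsilon> where "\<epsilon> = (1 - \<rho>) / (2 * B * C)"
  have \<sigma>: "0 \<le> \<sigma>" "\<sigma> < 1" using \<rho> by (auto simp: \<sigma>_def)
  have "0 < \<epsilon>" using \<rho> pos by (simp add: \<epsilon>_def)
  then obtain \<delta> where \<delta>: "0 < \<delta>"
    and rem: "\<And>y. norm (y - x) < \<delta> \<Longrightarrow> norm (f y - f x - D (y - x)) \<le> \<epsilon> * norm (y - x)"
    using der unfolding has_derivative_at_alt by blast
  have N_nonneg: "0 \<le> N v" for v
    using lower[of v] norm_ge_zero[of v] pos by (smt (verit) zero_le_mult_iff)
  have step: "N (f y - x) \<le> \<sigma> * N (y - x)" if "N (y - x) < \<delta> / C" for y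
  proof -
    have "C * N (y - x) < \<delta>" using that pos by (simp add: field_simps)
    then have "norm (y - x) < \<delta>" using lower[of "y - x"] by linarith
    then have r: "norm (f y - x - D (y - x)) \<le> \<epsilon> * norm (y - x)"
      using rem[of y] fixed by simp
    have "N (f y - x) \<le> N (D (y - x)) + N (f y - x - D (y - x))"
      using triangle[of "D (y - x)" "f y - x - D (y - x)"] by simp
    also have "\<dots> \<le> \<rho> * N (y - x) + B * (\<epsilon> * (C * N (y - x)))"
    proof (rule add_mono[OF contr])
      have "N (f y - x - D (y - x)) \<le> B * norm (f y - x - D (y - x))" by (rule upper)
      also have "\<dots> \<le> B * (\<epsilon> * norm (y - x))" using r pos by simp
      also have "\<dots> \<le> B * (\<epsilon> * (C * N (y - x)))"
        using lower[of "y - x"] pos \<open>0 < \<epsilon>\<close> by simp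
      finally show "N (f y - x - D (y - x)) \<le> B * (\<epsilon> * (C * N (y - x)))" .
    qed
    also have "\<dots> = \<sigma> * N (y - x)"
      using pos by (simp add: \<epsilon>_def \<sigma>_def field_simps)
    finally show ?thesis .
  qed
  have iter: "N ((f ^^ n) y - x) \<le> \<sigma> ^ n * N (y - x)" if y: "N (y - x) < \<delta> / C" for y n
  proof (induction n)
    case (Suc n)
    \<comment> \<open>Since \<open>N\<close> does not grow along the orbit, the iterate stays in the
      \<open>N\<close>-ball of radius \<open>\<delta> / C\<close>, where \<open>step\<close> applies
      again.\<close>
    have "\<sigma> ^ n * N (y - x) \<le> 1 * N (y - x)"
      by (rule mult_right_mono) (use \<sigma> N_nonneg in \<open>auto simp: power_le_one\<close>)
    then have "N ((f ^^ n) y - x) < \<delta> / C" using Suc y by linarith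
    from step[OF this] have "N ((f ^^ Suc n) y - x) \<le> \<sigma> * N ((f ^^ n) y - x)" by simp
    also have "\<dots> \<le> \<sigma> * (\<sigma> ^ n * N (y - x))" by (rule mult_left_mono[OF Suc \<sigma>(1)])
    finally show ?case by (simp add: mult.assoc)
  qed simp
  \<comment> \<open>This one geometric estimate in the metric yields both Lyapunov stability and
    attraction.\<close>
  have bound: "dist ((f ^^ n) y) x \<le> C * B * dist y x * \<sigma> ^ n"
    if "dist y x < \<delta> / (B * C)" for y n
  proof -
    have "B * norm (y - x) < \<delta> / C" using that pos by (simp add: dist_norm field_simps)
    then have "N (y - x) < \<delta> / C" using upper[of "y - x"] by linarith
    note iter[OF this, of n]
    also have "\<sigma> ^ n * N (y - x) \<le> \<sigma> ^ n * (B * norm (y - x))"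
      by (rule mult_left_mono[OF upper]) (use \<sigma> in simp)
    finally have "C * N ((f ^^ n) y - x) \<le> C * (\<sigma> ^ n * (B * norm (y - x)))"
      using pos by simp
    then show ?thesis
      using lower[of "(f ^^ n) y - x"] by (simp add: dist_norm mult_ac)
  qed
  show ?thesis
    unfolding locally_stable_def equilibrium_def
  proof (intro conjI allI impI)
    show "f x = x" by (rule fixed)
  next
    fix e :: real assume e: "0 < e"
    define d where "d = min (\<delta> / (B * C)) (e / (B * C))"
    show "\<exists>d>0. \<forall>y. dist y x < d \<longrightarrow> (\<forall>n. dist ((f ^^ n) y) x < e)"
    proof (intro exI[of _ d] conjI allI impI)
      show "0 < d" using \<delta> e pos by (simp add: d_def)
    next
      fix y n assume y: "dist y x < d"
      have "C * B * dist y x * \<sigma> ^ n \<le> C * B * dist y x * 1"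
        by (rule mult_left_mono) (use \<sigma> pos in \<open>auto simp: power_le_one\<close>)
      moreover have "C * B * dist y x < e" using y pos by (simp add: d_def field_simps)
      ultimately show "dist ((f ^^ n) y) x < e" using bound[of y n] y by (simp add: d_def)
    qed
  next
    show "\<exists>d>0. \<forall>y. dist y x < d \<longrightarrow> (\<lambda>n. (f ^^ n) y) \<longlonglongrightarrow> x"
    proof (intro exI[of _ "\<delta> / (B * C)"] conjI allI impI)
      show "0 < \<delta> / (B * C)" using \<delta> pos by simp
    next
      fix y assume y: "dist y x < \<delta> / (B * C)"
      have lim: "(\<lambda>n. C * B * dist y x * \<sigma> ^ n) \<longlonglongrightarrow> 0"
        by (intro tendsto_mult_right_zero LIMSEQ_realpow_zero \<sigma>)
      show "(\<lambda>n. (f ^^ n) y) \<longlonglongrightarrow> x"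
        unfolding tendsto_dist_iff[of _ x]
        by (rule tendsto_sandwich[OF _ _ tendsto_const lim])
          (use bound[OF y] in auto)
    qed
  qed
qed

text \<open>An orbit that starts on the expanding direction \<open>w\<close> stays in the cone where
  \<open>\<phi>\<close> dominates \<open>\<psi>\<close>, and there \<open>\<phi>\<close> grows
  geometrically, whereas stability would keep it bounded. Only dominance of \<open>\<kappa>\<close>
  matters: \<open>\<bar>\<mu>\<bar>\<close> may exceed 1 as well.\<close>

lemma not_locally_stable_if_dominant_expansion:
  fixes f :: "'a::real_normed_vector \<Rightarrow> 'a" and \<phi> \<psi> :: "'a \<Rightarrow> real"
  assumes der: "(f has_derivative D) (at x)"
    and lin: "bounded_linear \<phi>" "bounded_linear \<psi>"
    and eigen: "\<And>v. \<phi> (D v) = \<kappa> * \<phi> v" "\<And>v. \<psi> (D v) = \<mu> * \<psi> v"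
    and coord: "\<And>v. norm v \<le> C * (\<bar>\<phi> v\<bar> + \<bar>\<psi> v\<bar>)"
    and w: "\<phi> w \<noteq> 0" "\<psi> w = 0"
    and dom: "1 < \<bar>\<kappa>\<bar>" "\<bar>\<mu>\<bar> < \<bar>\<kappa>\<bar>"
  shows "\<not> locally_stable f x"
proof
  assume stable: "locally_stable f x"
  then have fixed: "f x = x" by (simp add: locally_stable_def equilibrium_def)
  interpret \<phi>: bounded_linear \<phi> by (rule lin)
  interpret \<psi>: bounded_linear \<psi> by (rule lin)
  obtain B1 where B1: "0 < B1" "\<And>v. \<bar>\<phi> v\<bar> \<le> norm v * B1"
    using \<phi>.pos_bounded by auto
  obtain B2 where B2: "0 < B2" "\<And>v. \<bar>\<psi> v\<bar> \<le> norm v * B2"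
    using \<psi>.pos_bounded by auto
  define B where "B = B1 + B2"
  have B: "0 < B" using B1 B2 by (simp add: B_def)
  have B\<phi>: "\<bar>\<phi> v\<bar> \<le> B * norm v" and B\<psi>: "\<bar>\<psi> v\<bar> \<le> B * norm v" for v
    using B1(2)[of v] B2(2)[of v] B1(1) B2(1) by (auto simp: B_def algebra_simps add_increasing add_increasing2)
  have "w \<noteq> 0" using w \<phi>.zero by auto
  then have "0 < C * (\<bar>\<phi> w\<bar> + \<bar>\<psi> w\<bar>)" using coord[of w] by (smt (verit) zero_less_norm_iff)
  then have C: "0 < C" by (auto simp: zero_less_mult_iff)
  \<comment> \<open>Half of the smaller gap: after a loss of \<open>\<eta>\<close> the growth rate
    \<open>r\<close> still exceeds 1, and after a gain of \<open>\<eta>\<close> the rate of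
    \<open>\<psi>\<close> is still at most \<open>r\<close>.\<close>
  define \<eta> where "\<eta> = min (\<bar>\<kappa>\<bar> - 1) (\<bar>\<kappa>\<bar> - \<bar>\<mu>\<bar>) / 2"
  define r where "r = \<bar>\<kappa>\<bar> - \<eta>"
  have \<eta>: "0 < \<eta>" "1 < r" "\<bar>\<mu>\<bar> + \<eta> \<le> r" using dom by (auto simp: \<eta>_def r_def min_def field_simps)
  \<comment> \<open>The factor 2 pays for \<open>\<bar>\<phi> v\<bar> + \<bar>\<psi> v\<bar> \<le> 2
    * \<bar>\<phi> v\<bar>\<close> on the cone, so that \<open>\<phi>\<close> and
    \<open>\<psi>\<close> of the remainder are at most
    \<open>\<eta> * \<bar>\<phi> v\<bar>\<close>.\<close>
  define \<epsilon> where "\<epsilon> = \<eta> / (2 * B * C)"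
  have "0 < \<epsilon>" using \<eta> B C by (simp add: \<epsilon>_def)
  then obtain \<delta> where \<delta>: "0 < \<delta>"
    and rem: "\<And>y. norm (y - x) < \<delta> \<Longrightarrow> norm (f y - f x - D (y - x)) \<le> \<epsilon> * norm (y - x)"
    using der unfolding has_derivative_at_alt by blast
  \<comment> \<open>The cone \<open>\<bar>\<psi>\<bar> \<le> \<bar>\<phi>\<bar>\<close> is forward invariant near \<open>x\<close>, and on it \<open>\<bar>\<phi>\<bar>\<close> grows by the factor \<open>r\<close>.\<close>
  have step: "\<bar>\<psi> (f y - x)\<bar> \<le> \<bar>\<phi> (f y - x)\<bar> \<and> r * \<bar>\<phi> (y - x)\<bar> \<le> \<bar>\<phi> (f y - x)\<bar>"
    if y: "norm (y - x) < \<delta>" and cone: "\<bar>\<psi> (y - x)\<bar> \<le> \<bar>\<phi> (y - x)\<bar>" for y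
  proof -
    define v where "v = y - x"
    define R where "R = f y - x - D v"
    have "norm R \<le> \<epsilon> * norm v" using rem[OF y] fixed by (simp add: R_def v_def)
    also have "\<dots> \<le> \<epsilon> * (C * (\<bar>\<phi> v\<bar> + \<bar>\<psi> v\<bar>))" using coord[of v] \<open>0 < \<epsilon>\<close> by simp
    also have "\<dots> \<le> \<epsilon> * (C * (2 * \<bar>\<phi> v\<bar>))" using cone C \<open>0 < \<epsilon>\<close> by (simp add: v_def)
    finally have "B * norm R \<le> B * (\<epsilon> * (C * (2 * \<bar>\<phi> v\<bar>)))" using B by simp
    also have "\<dots> = \<eta> * \<bar>\<phi> v\<bar>" using B C by (simp add: \<epsilon>_def field_simps)
    finally have R: "B * norm R \<le> \<eta> * \<bar>\<phi> v\<bar>" .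
    have fy: "f y - x = D v + R" by (simp add: R_def)
    have \<phi>R: "\<bar>\<phi> R\<bar> \<le> \<eta> * \<bar>\<phi> v\<bar>" and \<psi>R: "\<bar>\<psi> R\<bar> \<le> \<eta> * \<bar>\<phi> v\<bar>"
      using R B\<phi>[of R] B\<psi>[of R] by auto
    have "\<phi> (f y - x) = \<kappa> * \<phi> v + \<phi> R" by (simp add: fy \<phi>.add eigen)
    then have "\<bar>\<kappa>\<bar> * \<bar>\<phi> v\<bar> - \<bar>\<phi> R\<bar> \<le> \<bar>\<phi> (f y - x)\<bar>" unfolding abs_mult[symmetric] by linarith
    then have 1: "r * \<bar>\<phi> v\<bar> \<le> \<bar>\<phi> (f y - x)\<bar>" using \<phi>R by (simp add: r_def left_diff_distrib)
    have "\<psi> (f y - x) = \<mu> * \<psi> v + \<psi> R" by (simp add: fy \<psi>.add eigen)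
    then have "\<bar>\<psi> (f y - x)\<bar> \<le> \<bar>\<mu>\<bar> * \<bar>\<psi> v\<bar> + \<bar>\<psi> R\<bar>" unfolding abs_mult[symmetric] by linarith
    also have "\<dots> \<le> \<bar>\<mu>\<bar> * \<bar>\<phi> v\<bar> + \<eta> * \<bar>\<phi> v\<bar>"
      by (intro add_mono mult_left_mono \<psi>R) (use cone in \<open>auto simp: v_def\<close>)
    also have "\<dots> = (\<bar>\<mu>\<bar> + \<eta>) * \<bar>\<phi> v\<bar>" by (simp add: distrib_right)
    also have "\<dots> \<le> r * \<bar>\<phi> v\<bar>" by (rule mult_right_mono) (use \<eta> in auto)
    finally show ?thesis using 1 by (simp add: v_def)
  qed
  obtain d where d: "0 < d" "\<And>y n. dist y x < d \<Longrightarrow> dist ((f ^^ n) y) x < \<delta>"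
    using stable \<delta> unfolding locally_stable_def by metis
  \<comment> \<open>The starting point lies at distance \<open>d / 2\<close> from \<open>x\<close>
    on the line where \<open>\<psi>\<close> vanishes, hence inside the cone.\<close>
  define t where "t = d / (2 * norm w)"
  define y where "y = x + t *\<^sub>R w"
  have t: "0 < t" using d \<open>w \<noteq> 0\<close> by (simp add: t_def)
  have "dist y x < d" using d \<open>w \<noteq> 0\<close> by (simp add: y_def dist_norm t_def)
  note near = d(2)[OF this, unfolded dist_norm]
  have grow: "\<bar>\<psi> ((f ^^ n) y - x)\<bar> \<le> \<bar>\<phi> ((f ^^ n) y - x)\<bar>
      \<and> r ^ n * \<bar>\<phi> (y - x)\<bar> \<le> \<bar>\<phi> ((f ^^ n) y - x)\<bar>" for n
  proof (induction n)
    case 0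
    show ?case by (simp add: y_def \<psi>.scaleR w)
  next
    case (Suc n)
    have "r * (r ^ n * \<bar>\<phi> (y - x)\<bar>) \<le> r * \<bar>\<phi> ((f ^^ n) y - x)\<bar>"
      using Suc \<eta> by (intro mult_left_mono) auto
    then show ?case using step[OF near[of n]] Suc by (auto simp: mult.assoc)
  qed
  have \<phi>0: "0 < \<bar>\<phi> (y - x)\<bar>" using t w by (simp add: y_def \<phi>.scaleR)
  obtain n where "B * \<delta> / \<bar>\<phi> (y - x)\<bar> < r ^ n" using real_arch_pow[OF \<eta>(2)] by blast
  then have "B * \<delta> < r ^ n * \<bar>\<phi> (y - x)\<bar>" using \<phi>0 by (simp add: field_simps)
  also have "\<dots> \<le> \<bar>\<phi> ((f ^^ n) y - x)\<bar>" using grow by blast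
  also have "\<dots> \<le> B * norm ((f ^^ n) y - x)" by (rule B\<phi>)
  also have "\<dots> \<le> B * \<delta>" using near[of n] B by simp
  finally show False by simp
qed

section \<open>The symmetric equilibrium\<close>

lemma nonvanishing_equilibrium_bertrand_iff:
  fixes c k1 k2 :: real
  assumes "c > 0" "k1 > 0" "k2 > 0"
  shows "nonvanishing_equilibrium (bertrand_map c c k1 k2) p \<longleftrightarrow> p = vector [5 * c, 5 * c]"
proof
  assume "nonvanishing_equilibrium (bertrand_map c c k1 k2) p"
  then have eq: "bertrand_map c c k1 k2 p = p" and pos: "p $ 1 > 0" "p $ 2 > 0"
    by (auto simp: nonvanishing_equilibrium_def equilibrium_def)
  define x y s where "x = p $ 1" and "y = p $ 2" and "s = sqrt (x * y)"
  have xy: "x > 0" "y > 0" using pos by (auto simp: x_def y_def)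
  have s: "s > 0" using xy by (simp add: s_def)
  have q: "sqrt x + sqrt y > 0" using xy by (simp add: add_pos_pos)
  have "bertrand_map c c k1 k2 p $ 1 = x" "bertrand_map c c k1 k2 p $ 2 = y"
    using eq by (auto simp: x_def y_def)
  then have "x + k1 * ((- x * s + (2 * y + 3 * s) * c) / (2 * x\<^sup>2 * (sqrt x + sqrt y)\<^sup>2)) = x"
    "y + k2 * ((- y * s + (2 * x + 3 * s) * c) / (2 * y\<^sup>2 * (sqrt x + sqrt y)\<^sup>2)) = y"
    by (simp_all add: bertrand_map_def Let_def x_def y_def s_def)
  then have 1: "- x * s + (2 * y + 3 * s) * c = 0" and 2: "- y * s + (2 * x + 3 * s) * c = 0"
    using assms xy q by auto
  \<comment> \<open>Subtracting the two numerators cancels the term \<open>3 * s * c\<close>, and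
    the difference factors; positivity of the second factor forces equal prices.\<close>
  have "(x - y) * (s + 2 * c) = 0" using 1 2 by algebra
  then have "x = y" using s assms by auto
  then have "s = x" using xy by (simp add: s_def)
  with 1 \<open>x = y\<close> have "x * (5 * c - x) = 0" by algebra
  then have "x = 5 * c" using xy by auto
  then show "p = vector [5 * c, 5 * c]"
    using \<open>x = y\<close> by (simp add: vec_eq_iff forall_2 x_def y_def)
next
  assume "p = vector [5 * c, 5 * c]"
  moreover have "sqrt (5 * c * (5 * c)) = 5 * c" using assms by (subst real_sqrt_abs2) simp
  ultimately show "nonvanishing_equilibrium (bertrand_map c c k1 k2) p"
    using assms by (simp add: nonvanishing_equilibrium_def equilibrium_def vec_eq_iff forall_2
        bertrand_map_def Let_def)
qed

section \<open>The Jacobian at the equilibrium\<close>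

text \<open>The indices \<open>i\<close> and \<open>j\<close> are generic so that both components of
  the map are instances. The numerator of the quotient vanishes at the equilibrium, so only its own
  derivative, divided by the value of the denominator, contributes.\<close>

lemma has_derivative_price_update:
  fixes c k :: real and i j :: 2
  assumes c: "c > 0" and E: "E $ i = 5 * c" "E $ j = 5 * c"
  shows "((\<lambda>p :: real ^ 2. p $ i + k * ((- p $ i * sqrt (p $ i * p $ j)
             + (2 * p $ j + 3 * sqrt (p $ i * p $ j)) * c)
           / (2 * (p $ i)\<^sup>2 * (sqrt (p $ i) + sqrt (p $ j))\<^sup>2)))
     has_derivative (\<lambda>h. (1 - 6 * (k / (1000 * c\<^sup>2))) * h $ i + k / (1000 * c\<^sup>2) * h $ j)) (at E)"
proof -
  let ?h = "\<lambda>p :: real ^ 2. sqrt (p $ i * p $ j)"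
  let ?N = "\<lambda>p. - p $ i * ?h p + (2 * p $ j + 3 * ?h p) * c"
  let ?D = "\<lambda>p :: real ^ 2. 2 * (p $ i)\<^sup>2 * (sqrt (p $ i) + sqrt (p $ j))\<^sup>2"
  have r: "sqrt (5 * c * (5 * c)) = 5 * c" using c by (subst real_sqrt_abs2) simp
  have nth: "((\<lambda>p :: real ^ 2. p $ m) has_derivative (\<lambda>h. h $ m)) (at E)" for m
    by (rule bounded_linear_imp_has_derivative[OF bounded_linear_vec_nth])
  have pos: "0 < E $ i" "0 < E $ j" using c E by auto
  have h: "(?h has_derivative (\<lambda>h. (h $ i + h $ j) / 2)) (at E)"
  proof -
    have "0 < E $ i * E $ j" using pos by simp
    from has_derivative_real_sqrt[of "\<lambda>p. p $ i * p $ j" E, OF this has_derivative_mult[OF nth nth]]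
    show ?thesis
      by (rule has_derivative_eq_rhs) (use c in \<open>simp only: E r, auto simp: fun_eq_iff field_simps\<close>)
  qed
  have N: "(?N has_derivative (\<lambda>h. c * (h $ j - 6 * h $ i))) (at E)"
    by (rule h nth derivative_eq_intros refl)+
      (simp only: E r, auto simp: fun_eq_iff field_simps)
  \<comment> \<open>The existence of \<open>D'\<close> suffices: in the quotient rule it is
    multiplied by the numerator, which is 0 at \<open>E\<close>.\<close>
  obtain D' where D: "(?D has_derivative D') (at E)"
  proof -
    have "\<exists>D'. (?D has_derivative D') (at E)"
      by (rule exI) (rule derivative_intros nth pos)+
    then show ?thesis using that by blast
  qed
  have N0: "?N E = 0" by (simp only: E r) simp
  \<comment> \<open>With both prices \<open>5 * c\<close> this is 50 c^2 times (2 sqrt(5c))^2 = 20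
    c, the source of the constant 1000.\<close>
  have DE: "?D E = 1000 * c ^ 3"
    using c by (simp add: E power_mult_distrib power2_eq_square power3_eq_cube)
  have "((\<lambda>p. ?N p / ?D p) has_derivative (\<lambda>h. c * (h $ j - 6 * h $ i) / (1000 * c ^ 3))) (at E)"
    by (rule has_derivative_eq_rhs[OF has_derivative_divide'[OF N D]], unfold N0 DE)
      (use c in \<open>simp_all add: fun_eq_iff field_simps\<close>)
  from has_derivative_add[OF nth[of i] has_derivative_mult_right[OF this, of k]]
  show ?thesis
    by (rule has_derivative_eq_rhs) (use c in \<open>simp add: fun_eq_iff field_simps power2_eq_square power3_eq_cube\<close>)
qed

lemma has_derivative_bertrand_map:
  fixes c k1 k2 :: real
  assumes "c > 0"
  defines "a \<equiv> k1 / (1000 * c\<^sup>2)" and "b \<equiv> k2 / (1000 * c\<^sup>2)"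
  shows "(bertrand_map c c k1 k2 has_derivative
      (\<lambda>h. vector [(1 - 6 * a) * h $ 1 + a * h $ 2, b * h $ 1 + (1 - 6 * b) * h $ 2]))
    (at (vector [5 * c, 5 * c]))"
proof -
  have "((\<lambda>p. bertrand_map c c k1 k2 p $ i) has_derivative
      (\<lambda>h. (vector [(1 - 6 * a) * h $ 1 + a * h $ 2, b * h $ 1 + (1 - 6 * b) * h $ 2] :: real ^ 2) $ i))
    (at (vector [5 * c, 5 * c]))" for i
    using exhaust_2[of i]
      has_derivative_price_update[of c "vector [5 * c, 5 * c]" 1 2 k1]
      has_derivative_price_update[of c "vector [5 * c, 5 * c]" 2 1 k2] assms
    by (auto simp: bertrand_map_def Let_def add.commute mult.commute)
  then show ?thesis
    unfolding has_derivative_componentwise_within[of "bertrand_map c c k1 k2"]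
    by (auto simp: Basis_vec_def inner_axis)
qed

lemma jacobian_bertrand_map:
  fixes c k1 k2 :: real
  assumes "c > 0"
  defines "a \<equiv> k1 / (1000 * c\<^sup>2)" and "b \<equiv> k2 / (1000 * c\<^sup>2)"
  shows "jacobian (bertrand_map c c k1 k2) (at (vector [5 * c, 5 * c]))
    = vector [vector [1 - 6 * a, a], vector [b, 1 - 6 * b]]"
  using frechet_derivative_at[OF has_derivative_bertrand_map[OF assms(1), of k1 k2], symmetric]
  by (simp add: jacobian_def matrix_def vec_eq_iff forall_2 a_def b_def axis_def)

section \<open>Eigenvalues of the linearization\<close>

text \<open>The number \<open>r\<close> is the larger eigenvalue of the identity minus the linear
  part, whose trace is 6a + 6b and determinant 35ab. If \<open>s\<close> is the smaller one, then 0
  < s < r; hence \<open>r < 2\<close> puts both 1 - r and 1 - s in (-1, 1), while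
  \<open>r > 2\<close> gives 1 - r < -1 and |1 - s| < |1 - r|.\<close>

lemma linearization_stability_dichotomy:
  fixes f :: "real ^ 2 \<Rightarrow> real ^ 2" and a b :: real
  assumes ab: "a > 0" "b > 0"
    and der: "(f has_derivative
      (\<lambda>h. vector [(1 - 6 * a) * h $ 1 + a * h $ 2, b * h $ 1 + (1 - 6 * b) * h $ 2])) (at x)"
    and fixed: "f x = x"
  defines "r \<equiv> 3 * a + 3 * b + sqrt (9 * a\<^sup>2 - 17 * a * b + 9 * b\<^sup>2)"
  shows "r < 2 \<Longrightarrow> locally_stable f x" and "r > 2 \<Longrightarrow> \<not> locally_stable f x"
proof -
  define d where "d = sqrt (9 * a\<^sup>2 - 17 * a * b + 9 * b\<^sup>2)"
  have disc: "9 * a\<^sup>2 - 17 * a * b + 9 * b\<^sup>2 = 9 * (a - b)\<^sup>2 + a * b"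
    by (simp add: power2_eq_square algebra_simps)
  have disc_pos: "0 < 9 * a\<^sup>2 - 17 * a * b + 9 * b\<^sup>2"
    unfolding disc using ab by (intro add_nonneg_pos) auto
  then have d: "0 < d" "d\<^sup>2 = 9 * a\<^sup>2 - 17 * a * b + 9 * b\<^sup>2" by (auto simp: d_def)
  \<comment> \<open>The gap between the two squares is 35ab; it makes \<open>s\<close> positive, so
    the eigenvalue \<open>1 - s\<close> is below 1.\<close>
  have "d\<^sup>2 < (3 * a + 3 * b)\<^sup>2" using ab unfolding d by (simp add: power2_eq_square algebra_simps)
  then have d_less: "d < 3 * a + 3 * b" by (rule power2_less_imp_less) (use ab in simp)
  define s where "s = 3 * a + 3 * b - d"
  have r: "r = 3 * a + 3 * b + d" by (simp add: r_def d_def)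
  have rs: "0 < s" "s < r" using d d_less by (auto simp: r s_def)
  define L :: "real ^ 2 \<Rightarrow> real ^ 2" where
    "L = (\<lambda>h. vector [(1 - 6 * a) * h $ 1 + a * h $ 2, b * h $ 1 + (1 - 6 * b) * h $ 2])"
  \<comment> \<open>The left eigenvectors of \<open>L\<close>, for the eigenvalues \<open>1 - r\<close> and \<open>1 - s\<close>.\<close>
  define \<phi> where "\<phi> v = b * v $ 1 + (6 * a - r) * v $ 2" for v :: "real ^ 2"
  define \<psi> where "\<psi> v = b * v $ 1 + (6 * a - s) * v $ 2" for v :: "real ^ 2"
  \<comment> \<open>The characteristic equation for \<open>r\<close> and \<open>s\<close>; it is
    what makes \<open>\<phi>\<close> and \<open>\<psi>\<close> eigenfunctionals.\<close>
  have root: "a * b = (6 * a - r) * (6 * b - r)" "a * b = (6 * a - s) * (6 * b - s)"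
    using d(2) unfolding r s_def by algebra+
  have eigen: "\<phi> (L v) = (1 - r) * \<phi> v" "\<psi> (L v) = (1 - s) * \<psi> v" for v
    using root unfolding \<phi>_def \<psi>_def L_def vector_2 by algebra+
  have lin: "bounded_linear \<phi>" "bounded_linear \<psi>"
    unfolding \<phi>_def \<psi>_def
    by (intro bounded_linear_add bounded_linear_const_mult bounded_linear_vec_nth)+
  \<comment> \<open>The constant comes from inverting the change of coordinates:
    \<open>\<psi> - \<phi>\<close> is \<open>2 * d\<close> times the second entry, since
    \<open>r - s = 2 * d\<close>, and \<open>\<phi>\<close> then gives the first entry after
    division by \<open>b\<close>.\<close>
  define C where "C = (1 + \<bar>6 * a - r\<bar> / (2 * d)) / b + 1 / (2 * d)"
  have C: "0 < C" using ab d by (auto simp: C_def intro!: add_pos_pos divide_pos_pos add_pos_nonneg)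
  have coord: "norm v \<le> C * (\<bar>\<phi> v\<bar> + \<bar>\<psi> v\<bar>)" for v
  proof -
    define S where "S = \<bar>\<phi> v\<bar> + \<bar>\<psi> v\<bar>"
    have "2 * d * v $ 2 = \<psi> v - \<phi> v" by (simp add: \<phi>_def \<psi>_def r s_def algebra_simps)
    then have "\<bar>2 * d * v $ 2\<bar> \<le> S" unfolding S_def by linarith
    then have 2: "\<bar>v $ 2\<bar> \<le> S / (2 * d)" using d by (simp add: abs_mult field_simps)
    have "b * v $ 1 = \<phi> v - (6 * a - r) * v $ 2" by (simp add: \<phi>_def)
    then have "\<bar>b * v $ 1\<bar> \<le> S + \<bar>6 * a - r\<bar> * \<bar>v $ 2\<bar>" unfolding S_def abs_mult[symmetric] by linarith
    also have "\<dots> \<le> S + \<bar>6 * a - r\<bar> * (S / (2 * d))" using 2 by (intro add_left_mono mult_left_mono) auto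
    finally have "\<bar>v $ 1\<bar> \<le> (S + \<bar>6 * a - r\<bar> * (S / (2 * d))) / b"
      using ab by (simp add: abs_mult pos_le_divide_eq mult.commute)
    then have "\<bar>v $ 1\<bar> + \<bar>v $ 2\<bar> \<le> (S + \<bar>6 * a - r\<bar> * (S / (2 * d))) / b + S / (2 * d)"
      using 2 by (rule add_mono)
    also have "\<dots> = C * S" by (simp add: C_def add_divide_distrib distrib_right)
    finally show ?thesis
      using norm_le_l1_cart[of v] by (simp add: sum_2 S_def)
  qed
  note der' = der[folded L_def]
  {
    assume "r < 2"
    \<comment> \<open>The spectral radius of \<open>L\<close>; in the gauge
      \<open>\<bar>\<phi> v\<bar> + \<bar>\<psi> v\<bar>\<close> it is also a contraction
      rate.\<close>
    define \<rho> where "\<rho> = max \<bar>1 - r\<bar> \<bar>1 - s\<bar>"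
    obtain B1 where B1: "0 < B1" "\<And>v. \<bar>\<phi> v\<bar> \<le> norm v * B1"
      using bounded_linear.pos_bounded[OF lin(1)] by auto
    obtain B2 where B2: "0 < B2" "\<And>v. \<bar>\<psi> v\<bar> \<le> norm v * B2"
      using bounded_linear.pos_bounded[OF lin(2)] by auto
    show "locally_stable f x"
    proof (rule locally_stable_if_contracting_linearization
        [where N = "\<lambda>v. \<bar>\<phi> v\<bar> + \<bar>\<psi> v\<bar>" and C = C and B = "B1 + B2" and \<rho> = \<rho>, OF fixed der'])
      show "\<bar>\<phi> (u + v)\<bar> + \<bar>\<psi> (u + v)\<bar> \<le> \<bar>\<phi> u\<bar> + \<bar>\<psi> u\<bar> + (\<bar>\<phi> v\<bar> + \<bar>\<psi> v\<bar>)" for u v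
        using linear_add[OF bounded_linear.linear[OF lin(1)], of u v]
          linear_add[OF bounded_linear.linear[OF lin(2)], of u v] by linarith
      show "\<bar>\<phi> v\<bar> + \<bar>\<psi> v\<bar> \<le> (B1 + B2) * norm v" for v
        using B1(2)[of v] B2(2)[of v] by (simp add: algebra_simps)
      have "\<bar>1 - r\<bar> * \<bar>\<phi> v\<bar> \<le> \<rho> * \<bar>\<phi> v\<bar>" "\<bar>1 - s\<bar> * \<bar>\<psi> v\<bar> \<le> \<rho> * \<bar>\<psi> v\<bar>" for v
        by (intro mult_right_mono; simp add: \<rho>_def)+
      then show "\<bar>\<phi> (L v)\<bar> + \<bar>\<psi> (L v)\<bar> \<le> \<rho> * (\<bar>\<phi> v\<bar> + \<bar>\<psi> v\<bar>)" for v
        unfolding eigen abs_mult distrib_left by (rule add_mono)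
      show "\<rho> < 1" "0 \<le> \<rho>" using rs \<open>r < 2\<close> by (auto simp: \<rho>_def)
    qed (use coord C B1 B2 in auto)
  next
    assume "r > 2"
    \<comment> \<open>A vector spanning the kernel of \<open>\<psi>\<close>, that is, a right
      eigenvector of \<open>L\<close> for \<open>1 - r\<close>.\<close>
    define w :: "real ^ 2" where "w = vector [s - 6 * a, b]"
    show "\<not> locally_stable f x"
    proof (rule not_locally_stable_if_dominant_expansion[OF der' lin eigen coord])
      have "\<phi> w = b * (s - r)" by (simp add: \<phi>_def w_def algebra_simps)
      then show "\<phi> w \<noteq> 0" using rs ab by simp
      show "\<psi> w = 0" by (simp add: \<psi>_def w_def algebra_simps)
    qed (use rs \<open>r > 2\<close> in auto)
  }
qed

section \<open>The stability boundary in parameter space\<close>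

text \<open>The left side is homogeneous of degree one in \<open>a\<close> and \<open>b\<close>, so
  the factor 1/(1000 c^2) comes out. Comparing it with 2 thus compares
  \<open>threshold k1 k2\<close> with \<open>c\<^sup>2\<close>.\<close>

lemma threshold_scaled:
  fixes c k1 k2 :: real
  assumes "c > 0"
  defines "a \<equiv> k1 / (1000 * c\<^sup>2)" and "b \<equiv> k2 / (1000 * c\<^sup>2)"
  shows "3 * a + 3 * b + sqrt (9 * a\<^sup>2 - 17 * a * b + 9 * b\<^sup>2) = 2 * threshold k1 k2 / c\<^sup>2"
proof -
  define u where "u = 1000 * c\<^sup>2"
  have u: "0 < u" using assms by (simp add: u_def)
  have "9 * a\<^sup>2 - 17 * a * b + 9 * b\<^sup>2 = (9 * k1\<^sup>2 - 17 * k1 * k2 + 9 * k2\<^sup>2) / u\<^sup>2"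
    using u unfolding a_def b_def u_def[symmetric] by (simp add: field_simps power2_eq_square)
  then have "sqrt (9 * a\<^sup>2 - 17 * a * b + 9 * b\<^sup>2) = sqrt (9 * k1\<^sup>2 - 17 * k1 * k2 + 9 * k2\<^sup>2) / u"
    using u by (simp add: real_sqrt_divide)
  then show ?thesis
    using assms(1) by (simp add: a_def b_def threshold_def u_def field_simps)
qed

lemma bertrand_stability_dichotomy:
  fixes c k1 k2 :: real
  assumes "c > 0" "k1 > 0" "k2 > 0"
  shows "c\<^sup>2 > threshold k1 k2 \<Longrightarrow> locally_stable (bertrand_map c c k1 k2) (vector [5 * c, 5 * c])"
    and "c\<^sup>2 < threshold k1 k2 \<Longrightarrow> \<not> locally_stable (bertrand_map c c k1 k2) (vector [5 * c, 5 * c])"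
proof -
  have "bertrand_map c c k1 k2 (vector [5 * c, 5 * c]) = vector [5 * c, 5 * c]"
    using nonvanishing_equilibrium_bertrand_iff[OF assms, of "vector [5 * c, 5 * c]"]
    by (simp add: nonvanishing_equilibrium_def equilibrium_def)
  note * = linearization_stability_dichotomy[OF _ _ has_derivative_bertrand_map[OF assms(1)] this,
      unfolded threshold_scaled[OF assms(1)]]
  show "c\<^sup>2 > threshold k1 k2 \<Longrightarrow> locally_stable (bertrand_map c c k1 k2) (vector [5 * c, 5 * c])"
    by (rule *(1)) (use assms in \<open>auto simp: field_simps\<close>)
  show "c\<^sup>2 < threshold k1 k2 \<Longrightarrow> \<not> locally_stable (bertrand_map c c k1 k2) (vector [5 * c, 5 * c])"
    by (rule *(2)) (use assms in \<open>auto simp: field_simps\<close>)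
qed

text \<open>The strict inequalities define open sets on which stability is decided, so the boundary
  lies on the surface of equality. Conversely, every point of the surface is a limit from both sides
  by varying \<open>c\<close> alone, because the threshold does not involve \<open>c\<close>.
  Stability on the surface itself is left undecided.\<close>

lemma loses_stability_G_sym_iff:
  fixes c k1 k2 :: real
  assumes "c > 0" "k1 > 0" "k2 > 0"
  shows "loses_stability G_sym E_sym params (c, k1, k2) \<longleftrightarrow> c\<^sup>2 = threshold k1 k2"
proof -
  let ?St = "{r \<in> params. locally_stable (G_sym r) (E_sym r)}"
  let ?Un = "{r \<in> params. \<not> locally_stable (G_sym r) (E_sym r)}"
  have q: "(c, k1, k2) \<in> params" using assms by (simp add: params_def)
  have St: "(c', k1', k2') \<in> ?St" if "c' > 0" "k1' > 0" "k2' > 0" "c'\<^sup>2 > threshold k1' k2'" for c' k1' k2'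
    using that bertrand_stability_dichotomy(1) by (simp add: params_def G_sym_def E_sym_def)
  have Un: "(c', k1', k2') \<in> ?Un" if "c' > 0" "k1' > 0" "k2' > 0" "c'\<^sup>2 < threshold k1' k2'" for c' k1' k2'
    using that bertrand_stability_dichotomy(2) by (simp add: params_def G_sym_def E_sym_def)
  let ?A = "{r :: real \<times> real \<times> real. (fst r)\<^sup>2 > threshold (fst (snd r)) (snd (snd r))}"
  let ?B = "{r :: real \<times> real \<times> real. (fst r)\<^sup>2 < threshold (fst (snd r)) (snd (snd r))}"
  have op: "open ?A" "open ?B"
    unfolding threshold_def by (intro open_Collect_less continuous_intros; simp)+
  have "?A \<inter> ?Un = {}" "?B \<inter> ?St = {}"
    using St Un by (fastforce simp: params_def)+
  then have disj: "?A \<inter> closure ?Un = {}" "?B \<inter> closure ?St = {}"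
    by (simp_all only: open_Int_closure_eq_empty op)
  show ?thesis
  proof
    assume "loses_stability G_sym E_sym params (c, k1, k2)"
    then have "(c, k1, k2) \<in> closure ?St" "(c, k1, k2) \<in> closure ?Un"
      by (auto simp: loses_stability_def)
    then have "(c, k1, k2) \<notin> ?A" "(c, k1, k2) \<notin> ?B" using disj by blast+
    then show "c\<^sup>2 = threshold k1 k2" by simp
  next
    assume eq: "c\<^sup>2 = threshold k1 k2"
    have "(c, k1, k2) \<in> closure ?St"
      unfolding closure_approachable
    proof (intro allI impI)
      fix e :: real assume e: "0 < e"
      have "c\<^sup>2 < (c + e / 2)\<^sup>2" using e assms by (intro power_strict_mono) auto
      then have "(c + e / 2, k1, k2) \<in> ?St" using e assms eq by (intro St) auto
      moreover have "dist (c + e / 2, k1, k2) (c, k1, k2) < e"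
        using e by (simp add: dist_Pair_Pair dist_real_def)
      ultimately show "\<exists>y\<in>?St. dist y (c, k1, k2) < e" by blast
    qed
    moreover have "(c, k1, k2) \<in> closure ?Un"
      unfolding closure_approachable
    proof (intro allI impI)
      fix e :: real assume e: "0 < e"
      \<comment> \<open>The minimum with \<open>c\<close> keeps the lowered cost
        \<open>c - t\<close> positive, hence inside \<open>params\<close>.\<close>
      define t where "t = min e c / 2"
      have t: "0 < t" "t < e" "t < c" using e assms by (auto simp: t_def)
      have "(c - t)\<^sup>2 < c\<^sup>2" using t by (intro power_strict_mono) auto
      then have "(c - t, k1, k2) \<in> ?Un" using t assms eq by (intro Un) auto
      moreover have "dist (c - t, k1, k2) (c, k1, k2) < e"
        using t by (simp add: dist_Pair_Pair dist_real_def)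
      ultimately show "\<exists>y\<in>?Un. dist y (c, k1, k2) < e" by blast
    qed
    ultimately show "loses_stability G_sym E_sym params (c, k1, k2)"
      using q by (simp add: loses_stability_def)
  qed
qed

section \<open>Jury quantities on the stability boundary\<close>

theorem theorem3:
  fixes c k1 k2 :: real
  assumes "c > 0" and "k1 > 0" and "k2 > 0"
  shows
    "(\<forall>p. nonvanishing_equilibrium (bertrand_map c c k1 k2) p \<longleftrightarrow> p = vector [5 * c, 5 * c])
   \<and> (c\<^sup>2 > threshold k1 k2 \<longrightarrow>
        locally_stable (bertrand_map c c k1 k2) (vector [5 * c, 5 * c]))
   \<and> (c\<^sup>2 = threshold k1 k2 \<longrightarrow>
        may_undergo_period_doubling G_sym E_sym params (c, k1, k2))
   \<and> (may_undergo_period_doubling G_sym E_sym params (c, k1, k2) \<longrightarrow>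
        c\<^sup>2 = threshold k1 k2)
   \<and> \<not> may_undergo_fold G_sym E_sym params (c, k1, k2)
   \<and> \<not> may_undergo_neimark_sacker G_sym E_sym params (c, k1, k2)"
proof -
  define a b where "a = k1 / (1000 * c\<^sup>2)" and "b = k2 / (1000 * c\<^sup>2)"
  have ab: "0 < a" "0 < b" using assms by (auto simp: a_def b_def)
  define J where "J = jacobian (G_sym (c, k1, k2)) (at (E_sym (c, k1, k2)))"
  have J: "J = vector [vector [1 - 6 * a, a], vector [b, 1 - 6 * b]]"
    using jacobian_bertrand_map[OF assms(1), of k1 k2]
    by (simp add: J_def G_sym_def E_sym_def a_def b_def)
  have tr: "trace J = 2 - 6 * a - 6 * b" by (simp add: J trace_def sum_2)
  have det: "det J = (1 - 6 * a) * (1 - 6 * b) - a * b" by (simp add: J det_2)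
  \<comment> \<open>\<open>CD1 J\<close> equals 35ab, which is positive for all parameters.\<close>
  have CD1: "CD1 J \<noteq> 0"
    using ab by (simp add: CD1_def tr det algebra_simps)
  \<comment> \<open>On the surface the larger root equals 2, so the square root is
    \<open>2 - 3 * a - 3 * b\<close>; squaring gives 4 - 12(a + b) + 35ab = 0, and the left side is
    \<open>CD2 J\<close>.\<close>
  have CD2: "CD2 J = 0" if "c\<^sup>2 = threshold k1 k2"
  proof -
    have "3 * a + 3 * b + sqrt (9 * a\<^sup>2 - 17 * a * b + 9 * b\<^sup>2) = 2"
      using threshold_scaled[OF assms(1), of k1 k2, folded that a_def b_def] assms by simp
    then have "sqrt (9 * a\<^sup>2 - 17 * a * b + 9 * b\<^sup>2) = 2 - 3 * a - 3 * b" by simp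
    moreover have "0 \<le> 9 * (a - b)\<^sup>2 + a * b" using ab by simp
    then have "0 \<le> 9 * a\<^sup>2 - 17 * a * b + 9 * b\<^sup>2" by (simp add: power2_eq_square algebra_simps)
    ultimately have "9 * a\<^sup>2 - 17 * a * b + 9 * b\<^sup>2 = (2 - 3 * a - 3 * b)\<^sup>2"
      by (metis real_sqrt_pow2)
    then show ?thesis by (simp add: CD2_def tr det power2_eq_square algebra_simps)
  qed
  \<comment> \<open>\<open>CD3 J\<close> can vanish elsewhere, for instance at a = b = 12/35, where
    the equilibrium is already unstable. Stability is lost only on the threshold surface, where
    \<open>CD2 J = 0\<close>, so joint vanishing is the case to exclude.\<close>
  have CD3: "CD3 J \<noteq> 0" if "CD2 J = 0"
  proof
    assume "CD3 J = 0"
    \<comment> \<open>Then \<open>-1\<close> would be a double eigenvalue, but the discriminant is positive.\<close>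
    with that have "a + b = 2 / 3" "a * b = 4 / 35"
      by (simp_all add: CD2_def CD3_def tr det algebra_simps)
    moreover have "(a - b)\<^sup>2 = (a + b)\<^sup>2 - 4 * (a * b)" by (simp add: power2_eq_square algebra_simps)
    ultimately have "(a - b)\<^sup>2 = (2 / 3)\<^sup>2 - 4 * (4 / 35)" by (simp only:)
    then show False using zero_le_power2[of "a - b"] by (simp add: power2_eq_square)
  qed
  show ?thesis
    unfolding may_undergo_fold_def may_undergo_period_doubling_def may_undergo_neimark_sacker_def
      loses_stability_G_sym_iff[OF assms] J_def[symmetric]
    using nonvanishing_equilibrium_bertrand_iff[OF assms] bertrand_stability_dichotomy(1)[OF assms]
      CD1 CD2 CD3 by auto
qed

end
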